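(* Let $F(z)=\sum_{r=1}^R\delta_r e^{z\overline{\gamma_r}}$ be in the generic case described in the context, let $\varepsilon>0$ and $1\le r\le Q$. Then the zeros of $F$ which lie in $S_r^\varepsilon$ converge as $|z|\to\infty$ to the zeros of $G_r$, in the sense that the modulus of the differences of corresponding zeros converges to zero. Precisely: after discarding finitely many zeros of $F$ in $S_r^\varepsilon$ and finitely many zeros of $G_r$ in $S_r^\varepsilon$, there is a bijection $z\mapsto z'$ from the remaining zeros of $F$ in $S_r^\varepsilon$ (counted with multiplicity) onto the remaining zeros of $G_r$ in $S_r^\varepsilon$ such that $|z-z'|\to0$ as $|z|\to\infty$.
   Context: $F(z)=\sum_{r=1}^R F_r(z)$ with $F_r(z)=\delta_r e^{z\overline{\gamma_r}}$, where $R\ge2$, the $\gamma_r\in\mathbb{C}$ are all different and all $\delta_r\in\mathbb{C}$ are non-zero. For $z,w\in\mathbb{C}$, $z\cdot w=\mathrm{Re}(z\overline{w})$. $K$ is the convex hull of $\{\gamma_1,\dots,\gamma_R\}$. Generic case: the $\gamma_r$ are labelled so that $\gamma_1,\dots,\gamma_Q$ are the vertices of $K$ in anticlockwise order, and the remaining $\gamma_r$ lie in the interior of $K$ (no $\gamma_r$ lies on an edge of $K$ unless it is a vertex of $K$). If $K$ is a segment then $Q=R=2$ and the segment is regarded as having two edges, one for each $r$. For $1\le r\le Q$, $r_-=r-1$ if $r\ge2$ and $1_-=Q$. For $1\le r\le Q$: $G_r(z)=F_r(z)+F_{r_-}(z)$; $k_r=\log|\delta_{r_-}/\delta_r|$;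 $e_r=-i(\gamma_r-\gamma_{r_-})/|\gamma_r-\gamma_{r_-}|$ is the outward pointing unit normal to the edge $(\gamma_{r_-},\gamma_r)$ of $K$; and $$S_r^\varepsilon=\{z\in\mathbb{C}: z\cdot e_r\ge\gamma_r\cdot e_r\ \text{and}\ k_r-\varepsilon\le z\cdot(\gamma_r-\gamma_{r_-})\le k_r+\varepsilon\}.$$ *)

theory Defs
  imports "HOL-Complex_Analysis.Complex_Analysis"
begin

definition exp_term :: "(nat \<Rightarrow> complex) \<Rightarrow> (nat \<Rightarrow> complex) \<Rightarrow> nat \<Rightarrow> complex \<Rightarrow> complex" where
  "exp_term \<delta> \<gamma> r z = \<delta> r * exp (z * cnj (\<gamma> r))"

definition exp_poly :: "nat \<Rightarrow> (nat \<Rightarrow> complex) \<Rightarrow> (nat \<Rightarrow> complex) \<Rightarrow> complex \<Rightarrow> complex" where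
  "exp_poly R \<delta> \<gamma> z = (\<Sum>r = 1..R. exp_term \<delta> \<gamma> r z)"

definition prev :: "nat \<Rightarrow> nat \<Rightarrow> nat" where
  "prev Q r = (if r = 1 then Q else r - 1)"

text \<open>The product \<open>z \<cdot> w = Re (z * cnj w)\<close> on the complex plane is the library's inner product.\<close>

lemma inner_complex_eq_Re: "z \<bullet> w = Re (z * cnj w)"
  by (simp add: inner_complex_def)

text \<open>The points \<open>\<gamma> 1, \<dots>, \<gamma> Q\<close> are exactly the vertices of the polygon \<open>K\<close>, each listed once,
  and they are listed anticlockwise: going from a vertex to the next one (cyclically) means
  traversing an edge of \<open>K\<close> with \<open>K\<close> on the left, \<open>Im ((x - a) * cnj (b - a)) \<ge> 0\<close> being the
  closed half-plane to the left of the directed line from \<open>a\<close> to \<open>b\<close>.  If \<open>K\<close> is a segment, it is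
  its own only edge, traversed once in each direction.\<close>

definition anticlockwise_vertices :: "complex set \<Rightarrow> nat \<Rightarrow> (nat \<Rightarrow> complex) \<Rightarrow> bool" where
  "anticlockwise_vertices K Q \<gamma> \<longleftrightarrow>
     bij_betw \<gamma> {1..Q} {v. v extreme_point_of K} \<and>
     (\<forall>r\<in>{1..Q}. closed_segment (\<gamma> (prev Q r)) (\<gamma> r) edge_of K \<and>
        (\<forall>x\<in>K. Im ((x - \<gamma> (prev Q r)) * cnj (\<gamma> r - \<gamma> (prev Q r))) \<ge> 0))"

text \<open>\<open>interior\<close> is the interior in the plane.  If the hull is a segment it is empty, so the last
  condition then forces \<open>R = Q = 2\<close>.\<close>

definition generic_case :: "nat \<Rightarrow> nat \<Rightarrow> (nat \<Rightarrow> complex) \<Rightarrow> (nat \<Rightarrow> complex) \<Rightarrow> bool" where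
  "generic_case R Q \<delta> \<gamma> \<longleftrightarrow>
     R \<ge> 2 \<and> Q \<le> R \<and> inj_on \<gamma> {1..R} \<and> (\<forall>r\<in>{1..R}. \<delta> r \<noteq> 0) \<and>
     anticlockwise_vertices (convex hull (\<gamma> ` {1..R})) Q \<gamma> \<and>
     (\<forall>s\<in>{Q<..R}. \<gamma> s \<in> interior (convex hull (\<gamma> ` {1..R})))"

definition edge_sum :: "nat \<Rightarrow> (nat \<Rightarrow> complex) \<Rightarrow> (nat \<Rightarrow> complex) \<Rightarrow> nat \<Rightarrow> complex \<Rightarrow> complex" where
  "edge_sum Q \<delta> \<gamma> r z = exp_term \<delta> \<gamma> r z + exp_term \<delta> \<gamma> (prev Q r) z"

definition edge_offset :: "nat \<Rightarrow> (nat \<Rightarrow> complex) \<Rightarrow> nat \<Rightarrow> real" where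
  "edge_offset Q \<delta> r = ln (norm (\<delta> (prev Q r) / \<delta> r))"

definition edge_normal :: "nat \<Rightarrow> (nat \<Rightarrow> complex) \<Rightarrow> nat \<Rightarrow> complex" where
  "edge_normal Q \<gamma> r =
     - \<i> * (\<gamma> r - \<gamma> (prev Q r)) / complex_of_real (norm (\<gamma> r - \<gamma> (prev Q r)))"

definition edge_strip ::
  "nat \<Rightarrow> (nat \<Rightarrow> complex) \<Rightarrow> (nat \<Rightarrow> complex) \<Rightarrow> nat \<Rightarrow> real \<Rightarrow> complex set" where
  "edge_strip Q \<delta> \<gamma> r \<epsilon> =
     {z. z \<bullet> edge_normal Q \<gamma> r \<ge> \<gamma> r \<bullet> edge_normal Q \<gamma> r \<and>
         edge_offset Q \<delta> r - \<epsilon> \<le> z \<bullet> (\<gamma> r - \<gamma> (prev Q r)) \<and>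
         z \<bullet> (\<gamma> r - \<gamma> (prev Q r)) \<le> edge_offset Q \<delta> r + \<epsilon>}"

text \<open>Zeros counted with multiplicity: a zero \<open>z\<close> of order \<open>m\<close> is represented by the \<open>m\<close> pairs
  \<open>(z, 0), \<dots>, (z, m - 1)\<close>.  Meaningful for analytic \<open>f\<close> not vanishing identically near \<open>z\<close>.\<close>

definition zeros_with_mult :: "(complex \<Rightarrow> complex) \<Rightarrow> complex set \<Rightarrow> (complex \<times> nat) set" where
  "zeros_with_mult f S = {(z, j). z \<in> S \<and> f z = 0 \<and> int j < zorder f z}"

end

theory Submission
  imports Defs
begin

text \<open>Write \<open>a\<close> and \<open>b\<close> for the ends of the edge, \<open>d = b - a\<close>, and \<open>e\<close> for its outward normal.  In the
  strip \<open>z \<bullet> d\<close> is bounded and \<open>z \<bullet> e\<close> is bounded below, so a point of the strip tends to infinity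
  exactly when \<open>z \<bullet> e\<close> does.  Every frequency other than \<open>a\<close> and \<open>b\<close> lies strictly on the inner
  side of the line through the edge (\<open>third_point_below_edge_line\<close>); relative to the term with
  frequency \<open>a\<close> its term in \<open>F\<close> is therefore exponentially small in \<open>z \<bullet> e\<close>
  (\<open>other_terms_negligible\<close>).

  The edge sum \<open>G\<close>, divided by the same term, is \<open>1 - exp (z * cnj d - \<Lambda>)\<close> for a constant \<open>\<Lambda>\<close>.  Its
  zeros are simple and equally spaced on the centre line \<open>z \<bullet> d = Re \<Lambda>\<close> of the strip, and at
  distance at least \<open>\<rho>\<close> from all of them its modulus is bounded below by a positive constant
  depending on \<open>\<rho>\<close> only (\<open>norm_one_minus_exp_ge\<close>).  Hence, far out in the strip and away from the
  zeros of \<open>G\<close>, the difference \<open>F - G\<close> is smaller than \<open>G\<close>, and Rouche's theorem on small circles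
  about the zeros of \<open>G\<close> matches the zeros (\<open>matching_zeros_at_infinity\<close>).\<close>

section \<open>Zeros of holomorphic functions with multiplicity\<close>

lemma finite_zeros_with_mult_compact:
  assumes "f holomorphic_on S" "open S" "connected S" "compact K" "K \<subseteq> S"
    and "z0 \<in> S" "f z0 \<noteq> 0"
  shows "finite (zeros_with_mult f K)"
proof -
  have "finite {z \<in> K. f z = 0}"
  proof (cases "f constant_on S")
    case True
    with assms(5-7) have "{z \<in> K. f z = 0} = {}"
      unfolding constant_on_def by (metis (mono_tags, lifting) Collect_empty_eq subsetD)
    then show ?thesis by (simp only: finite.emptyI)
  qed (use holomorphic_compact_finite_zeros assms in blast)
  then have "finite (SIGMA z:{z \<in> K. f z = 0}. {..<nat (zorder f z)})"
    by blast
  then show ?thesis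
    by (rule finite_subset[rotated]) (auto simp: zeros_with_mult_def)
qed

lemma zorder_simple_zero_DERIV:
  assumes "f holomorphic_on S" "open S" "z \<in> S" "f z = 0"
    and "(f has_field_derivative D) (at z)" "D \<noteq> 0"
  shows "zorder f z = 1"
  using zorder_zero_eqI[OF assms(1-3), of 1] assms(4-6) by (simp add: DERIV_imp_deriv)

text \<open>Rouche's theorem equates the numbers of zeros of \<open>F\<close> and \<open>G\<close> in the disc, counted with
  multiplicity.  Here the number is one, and since every zero contributes at least one, it is
  accounted for by a single simple zero.\<close>

lemma Rouche_simple_zero:
  fixes F G :: "complex \<Rightarrow> complex"
  assumes hol: "F holomorphic_on ball a R" "G holomorphic_on ball a R"
    and \<rho>: "0 < \<rho>" "\<rho> < R"
    and zero: "\<And>z. z \<in> ball a R \<Longrightarrow> G z = 0 \<longleftrightarrow> z = a"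
    and simple: "zorder G a = 1"
    and less: "\<And>z. z \<in> sphere a \<rho> \<Longrightarrow> norm (F z - G z) < norm (G z)"
  shows "\<exists>\<zeta>. \<zeta> \<in> ball a \<rho> \<and> zorder F \<zeta> = 1 \<and> (\<forall>z \<in> ball a \<rho>. F z = 0 \<longleftrightarrow> z = \<zeta>)"
proof -
  \<comment> \<open>The zeros of \<open>F\<close> might accumulate at the boundary of the large disc, so work in a slightly
    smaller one.\<close>
  define R' where "R' = (\<rho> + R) / 2"
  have R': "\<rho> < R'" "R' < R" using \<rho> by (auto simp: R'_def)
  have sub: "ball a R' \<subseteq> cball a R'" "cball a R' \<subseteq> ball a R" using R' by auto
  have Fsph: "F z \<noteq> 0" if "z \<in> sphere a \<rho>" for z
    using less[OF that] by (auto simp: norm_minus_commute)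
  define Z where "Z = {z \<in> ball a R'. F z = 0}"
  define Z' where "Z' = {z \<in> ball a \<rho>. F z = 0}"
  have z1: "a + of_real \<rho> \<in> sphere a \<rho>" using \<rho> by (simp add: dist_norm)
  have nz: "\<exists>z\<in>ball a R. F z \<noteq> 0"
    using Fsph[OF z1] z1 \<rho> by (intro bexI[of _ "a + of_real \<rho>"]) auto
  have finZ: "finite Z"
  proof (cases "F constant_on ball a R")
    case True
    with nz have "\<forall>z\<in>ball a R. F z \<noteq> 0" unfolding constant_on_def by auto
    with sub have "Z = {}" unfolding Z_def by blast
    then show ?thesis by simp
  next
    case False
    have "finite {z \<in> cball a R'. F z = 0}"
      by (rule holomorphic_compact_finite_zeros[OF hol(1) _ _ _ sub(2) False]) auto
    then show ?thesis by (rule finite_subset[rotated]) (use sub in \<open>auto simp: Z_def\<close>)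
  qed
  have Z'sub: "Z' \<subseteq> Z" using R' by (auto simp: Z_def Z'_def)
  have GZ: "{z \<in> ball a R'. G z = 0} = {a}"
    using zero R' \<rho> by (auto simp: subset_iff)
  have wn_in: "winding_number (circlepath a \<rho>) z = 1" if "z \<in> ball a \<rho>" for z
    using that by (intro winding_number_circlepath) (simp add: dist_norm norm_minus_commute)
  have wn_out: "winding_number (circlepath a \<rho>) z = 0" if "z \<notin> cball a \<rho>" for z
    by (rule winding_number_zero_outside[of _ "cball a \<rho>"]) (use that \<rho> in \<open>auto\<close>)
  have "(\<Sum>p\<in>{p\<in>ball a R'. G p + (F p - G p) = 0}.
            winding_number (circlepath a \<rho>) p * zorder (\<lambda>p. G p + (F p - G p)) p)
      = (\<Sum>p\<in>{p\<in>ball a R'. G p = 0}. winding_number (circlepath a \<rho>) p * zorder G p)"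
  proof (rule Rouche_theorem)
    show "finite {p \<in> ball a R'. G p + (F p - G p) = 0}" using finZ by (simp add: Z_def)
    show "finite {p \<in> ball a R'. G p = 0}" unfolding GZ by simp
    show "G holomorphic_on ball a R'" "(\<lambda>p. F p - G p) holomorphic_on ball a R'"
      using sub hol by (auto intro!: holomorphic_intros elim!: holomorphic_on_subset)
    show "path_image (circlepath a \<rho>) \<subseteq> ball a R'" using \<rho> R' by auto
    show "\<forall>z\<in>path_image (circlepath a \<rho>). norm (F z - G z) < norm (G z)"
      using less \<rho> by auto
    show "\<forall>z. z \<notin> ball a R' \<longrightarrow> winding_number (circlepath a \<rho>) z = 0"
      using wn_out R' by force
  qed auto
  then have "(\<Sum>p\<in>Z. winding_number (circlepath a \<rho>) p * zorder F p) = 1"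
    unfolding GZ using wn_in[of a] \<rho> by (simp add: Z_def simple)
  also have "(\<Sum>p\<in>Z. winding_number (circlepath a \<rho>) p * zorder F p)
      = (\<Sum>p\<in>Z'. winding_number (circlepath a \<rho>) p * zorder F p)"
  proof (rule sum.mono_neutral_right[OF finZ Z'sub], rule ballI)
    fix p assume p: "p \<in> Z - Z'"
    then have "p \<notin> sphere a \<rho>" using Fsph unfolding Z_def by blast
    with p have "p \<notin> cball a \<rho>" by (auto simp: Z_def Z'_def)
    then show "winding_number (circlepath a \<rho>) p * zorder F p = 0" by (simp add: wn_out)
  qed
  also have "\<dots> = (\<Sum>p\<in>Z'. of_int (zorder F p))"
    by (intro sum.cong) (auto simp: wn_in Z'_def)
  finally have "of_int (\<Sum>p\<in>Z'. zorder F p) = (of_int 1 :: complex)" by simp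
  then have one: "(\<Sum>p\<in>Z'. zorder F p) = 1" by (simp only: of_int_eq_iff)
  have pos: "zorder F p \<ge> 1" if "p \<in> Z'" for p
  proof -
    have "p \<in> ball a R" "F p = 0" using that \<rho> by (auto simp: Z'_def)
    with zorder_exist_zero[OF hol(1) _ _ _ nz, of p] show ?thesis by auto
  qed
  have finZ': "finite Z'" using finZ Z'sub finite_subset by blast
  have "Z' \<noteq> {}" using one by auto
  then obtain \<zeta> where \<zeta>: "\<zeta> \<in> Z'" by blast
  have split: "zorder F \<zeta> + (\<Sum>p\<in>Z' - {\<zeta>}. zorder F p) = 1"
    using one sum.remove[OF finZ' \<zeta>, of "zorder F"] by simp
  have "int (card (Z' - {\<zeta>})) \<le> (\<Sum>p\<in>Z' - {\<zeta>}. zorder F p)"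
    using sum_mono[of "Z' - {\<zeta>}" "\<lambda>_. 1" "zorder F"] pos by auto
  with split pos[OF \<zeta>] have "zorder F \<zeta> = 1" "card (Z' - {\<zeta>}) = 0" by linarith+
  moreover from this(2) finZ' have "Z' - {\<zeta>} = {}" by (metis card_0_eq finite_Diff)
  ultimately have "zorder F \<zeta> = 1" "Z' = {\<zeta>}" using \<zeta> by auto
  then show ?thesis unfolding Z'_def by blast
qed

section \<open>Matching the zeros of two functions at infinity\<close>

text \<open>If \<open>F - G\<close> is smaller than \<open>G\<close> far out in \<open>S\<close> and away from the zeros of \<open>G\<close>, then \<open>F\<close> has no
  zeros there, so every far zero of \<open>F\<close> is close to a zero of \<open>G\<close>; conversely, Rouche's theorem on
  the circle of radius \<open>\<rho>\<close> about a far zero \<open>w\<close> of \<open>G\<close> gives exactly one zero \<open>\<zeta> w\<close> of \<open>F\<close> inside,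
  which is simple.  The matching is \<open>\<zeta> w \<mapsto> w\<close>.  The circles of the fixed radius \<open>\<rho>\<close> suffice to
  define it; that \<open>\<zeta> w - w\<close> tends to zero comes from the domination hypothesis with small \<open>r\<close>.\<close>

lemma matching_zeros_at_infinity:
  fixes F G :: "complex \<Rightarrow> complex"
  assumes hol: "F holomorphic_on UNIV" "G holomorphic_on UNIV"
    and F_nz: "F z0 \<noteq> 0" and G_nz: "G z1 \<noteq> 0"
    and \<rho>: "0 < \<rho>"
    and simple: "\<And>w. G w = 0 \<Longrightarrow> zorder G w = 1"
    and sep: "\<And>w w'. G w = 0 \<Longrightarrow> G w' = 0 \<Longrightarrow> w \<noteq> w' \<Longrightarrow> 2 * \<rho> \<le> dist w w'"
    and inside: "\<And>w. w \<in> S \<Longrightarrow> G w = 0 \<Longrightarrow> L \<le> norm w \<Longrightarrow> cball w \<rho> \<subseteq> S"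
    and dominated: "\<And>r. 0 < r \<Longrightarrow> \<exists>M. \<forall>z\<in>S. M \<le> norm z \<and> (\<forall>w\<in>S. G w = 0 \<longrightarrow> r \<le> dist w z)
                        \<longrightarrow> norm (F z - G z) < norm (G z)"
  shows "\<exists>A B g. finite A \<and> A \<subseteq> zeros_with_mult F S \<and> finite B \<and> B \<subseteq> zeros_with_mult G S \<and>
           bij_betw g (zeros_with_mult F S - A) (zeros_with_mult G S - B) \<and>
           (\<forall>\<eta>>0. \<exists>M. \<forall>p \<in> zeros_with_mult F S - A.
              M \<le> norm (fst p) \<longrightarrow> norm (fst p - fst (g p)) < \<eta>)"
proof -
  obtain M1 where M1: "\<And>z. z \<in> S \<Longrightarrow> M1 \<le> norm z \<Longrightarrow> (\<forall>w\<in>S. G w = 0 \<longrightarrow> \<rho> \<le> dist w z)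
      \<Longrightarrow> norm (F z - G z) < norm (G z)"
    using dominated[OF \<rho>] by blast
  define N where "N = max L (M1 + \<rho>)"
  define Z where "Z = {w \<in> S. G w = 0 \<and> N \<le> norm w}"
  have Z: "w \<in> S" "G w = 0" "cball w \<rho> \<subseteq> S" if "w \<in> Z" for w
    using that inside by (auto simp: Z_def N_def)
  have "\<exists>\<zeta>. \<zeta> \<in> ball w \<rho> \<and> zorder F \<zeta> = 1 \<and> (\<forall>z \<in> ball w \<rho>. F z = 0 \<longleftrightarrow> z = \<zeta>)"
    if "w \<in> Z" for w
  proof (rule Rouche_simple_zero[where R = "2 * \<rho>"])
    show "F holomorphic_on ball w (2 * \<rho>)" "G holomorphic_on ball w (2 * \<rho>)"
      using hol holomorphic_on_subset by blast+
    show "0 < \<rho>" "\<rho> < 2 * \<rho>" using \<rho> by auto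
    show "zorder G w = 1" using simple Z that by auto
    show "G z = 0 \<longleftrightarrow> z = w" if "z \<in> ball w (2 * \<rho>)" for z
      using sep[of w z] Z(2)[OF \<open>w \<in> Z\<close>] that by auto
    show "norm (F z - G z) < norm (G z)" if z: "z \<in> sphere w \<rho>" for z
    proof (rule M1)
      show "z \<in> S" using Z(3)[OF \<open>w \<in> Z\<close>] z by auto
      have "norm w \<le> norm z + dist w z"
        using norm_triangle_sub[of w z] by (simp add: dist_norm)
      then show "M1 \<le> norm z" using \<open>w \<in> Z\<close> z by (auto simp: Z_def N_def)
      show "\<forall>w'\<in>S. G w' = 0 \<longrightarrow> \<rho> \<le> dist w' z"
      proof (intro ballI impI)
        fix w' assume w': "w' \<in> S" "G w' = 0"
        show "\<rho> \<le> dist w' z"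
        proof (cases "w' = w")
          case False
          have "2 * \<rho> \<le> dist w w'" using sep[OF Z(2)[OF \<open>w \<in> Z\<close>] w'(2)] False by simp
          also have "\<dots> \<le> dist w z + dist w' z" by (rule dist_triangle2)
          finally show ?thesis using z by simp
        qed (use z in auto)
      qed
    qed
  qed
  then obtain \<zeta> where \<zeta>: "\<zeta> w \<in> ball w \<rho>" "zorder F (\<zeta> w) = 1"
      "\<forall>z \<in> ball w \<rho>. F z = 0 \<longleftrightarrow> z = \<zeta> w" if "w \<in> Z" for w
    by metis
  \<comment> \<open>Discs of radius \<open>\<rho>\<close> about distinct zeros of \<open>G\<close> are disjoint, so a point in such a disc
    determines its centre.\<close>
  have centre: "w = w'" if "G w = 0" "G w' = 0" "dist w z < \<rho>" "dist w' z < \<rho>" for w w' z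
    using sep[OF that(1,2)] dist_triangle2[of w w' z] that(3,4) by linarith
  have inj: "inj_on \<zeta> Z"
  proof (rule inj_onI)
    fix w w' assume "w \<in> Z" "w' \<in> Z" "\<zeta> w = \<zeta> w'"
    then show "w = w'" using centre[of w w' "\<zeta> w"] \<zeta>(1)[of w] \<zeta>(1)[of w'] Z(2) by auto
  qed
  define A where "A = zeros_with_mult F S - \<zeta> ` Z \<times> {0}"
  define B where "B = zeros_with_mult G S - Z \<times> {0}"
  define g :: "complex \<times> nat \<Rightarrow> complex \<times> nat" where "g = (\<lambda>p. (the_inv_into Z \<zeta> (fst p), 0))"
  have FZ: "\<zeta> ` Z \<times> {0} \<subseteq> zeros_with_mult F S"
  proof -
    have "\<zeta> w \<in> S \<and> F (\<zeta> w) = 0 \<and> zorder F (\<zeta> w) = 1" if "w \<in> Z" for w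
      using \<zeta>[OF that] Z(3)[OF that] by auto
    then show ?thesis by (auto simp: zeros_with_mult_def)
  qed
  have GZ: "Z \<times> {0} \<subseteq> zeros_with_mult G S"
    using simple by (auto simp: Z_def zeros_with_mult_def)
  have "A \<subseteq> zeros_with_mult F (cball 0 (N + \<rho>))"
  proof (rule subrelI)
    fix z j assume zj: "(z, j) \<in> A"
    then have z: "z \<in> S" "F z = 0" "int j < zorder F z"
      by (auto simp: A_def zeros_with_mult_def)
    have "norm z \<le> N + \<rho>"
    proof (rule ccontr)
      assume big: "\<not> norm z \<le> N + \<rho>"
      then have "M1 \<le> norm z" using \<rho> by (auto simp: N_def)
      with M1[OF z(1)] z(2) have "\<not> (\<forall>w\<in>S. G w = 0 \<longrightarrow> \<rho> \<le> dist w z)" by auto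
      then obtain w where w: "w \<in> S" "G w = 0" "dist w z < \<rho>" by (auto simp: not_le)
      have "norm z \<le> norm w + dist w z"
        using norm_triangle_sub[of z w] by (simp add: dist_norm norm_minus_commute)
      with w big have "w \<in> Z" by (auto simp: Z_def)
      with \<zeta>[OF this] w z have "z = \<zeta> w" "j = 0" by auto
      with \<open>w \<in> Z\<close> zj show False by (auto simp: A_def)
    qed
    with z show "(z, j) \<in> zeros_with_mult F (cball 0 (N + \<rho>))"
      by (auto simp: zeros_with_mult_def)
  qed
  then have finA: "finite A"
    using finite_zeros_with_mult_compact[OF hol(1) _ _ compact_cball _ _ F_nz] finite_subset
    by (metis open_UNIV connected_UNIV subset_UNIV UNIV_I)
  have "B \<subseteq> zeros_with_mult G (cball 0 N)"
    using simple by (auto simp: B_def Z_def zeros_with_mult_def)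
  then have finB: "finite B"
    using finite_zeros_with_mult_compact[OF hol(2) _ _ compact_cball _ _ G_nz] finite_subset
    by (metis open_UNIV connected_UNIV subset_UNIV UNIV_I)
  have FA: "zeros_with_mult F S - A = \<zeta> ` Z \<times> {0}" using FZ by (auto simp: A_def)
  have GB: "zeros_with_mult G S - B = Z \<times> {0}" using GZ by (auto simp: B_def)
  have bij: "bij_betw g (\<zeta> ` Z \<times> {0::nat}) (Z \<times> {0})"
    by (rule bij_betwI[where g = "\<lambda>p. (\<zeta> (fst p), 0)"])
       (auto simp: g_def the_inv_into_f_f[OF inj])
  have close: "\<exists>M. \<forall>p \<in> \<zeta> ` Z \<times> {0::nat}. M \<le> norm (fst p) \<longrightarrow> norm (fst p - fst (g p)) < \<eta>"
    if "\<eta> > 0" for \<eta>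
  proof -
    obtain M where M: "\<And>z. z \<in> S \<Longrightarrow> M \<le> norm z \<Longrightarrow>
        (\<forall>w\<in>S. G w = 0 \<longrightarrow> min \<eta> \<rho> \<le> dist w z) \<Longrightarrow> norm (F z - G z) < norm (G z)"
      using dominated[of "min \<eta> \<rho>"] \<open>\<eta> > 0\<close> \<rho> by auto
    have "norm (\<zeta> w - w) < \<eta>" if w: "w \<in> Z" and big: "M \<le> norm (\<zeta> w)" for w
    proof -
      have \<zeta>w: "\<zeta> w \<in> S" "F (\<zeta> w) = 0" using \<zeta>[OF w] Z(3)[OF w] by auto
      with M[OF \<zeta>w(1) big] have "\<not> (\<forall>w'\<in>S. G w' = 0 \<longrightarrow> min \<eta> \<rho> \<le> dist w' (\<zeta> w))"
        by auto
      then obtain w' where w': "w' \<in> S" "G w' = 0" "dist w' (\<zeta> w) < min \<eta> \<rho>"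
        by (meson not_le)
      then have "w' = w" using centre[of w' w "\<zeta> w"] \<zeta>(1)[OF w] Z(2)[OF w] by auto
      with w' show ?thesis by (simp add: dist_norm norm_minus_commute)
    qed
    then show ?thesis
      by (intro exI[of _ M]) (auto simp: g_def the_inv_into_f_f[OF inj])
  qed
  show ?thesis
    by (intro exI[of _ A] exI[of _ B] exI[of _ g])
       (use finA finB bij close FA GB in \<open>auto simp: A_def B_def\<close>)
qed

section \<open>Geometry of an edge and its strip\<close>

text \<open>The vectors \<open>d / norm d\<close> and \<open>e\<close>, its rotation by a quarter turn clockwise, form an orthonormal
  basis of the plane.  The strip bounds the coordinate along \<open>d\<close>, and its points tend to infinity
  in the direction \<open>e\<close>.\<close>

lemma inner_edge_coordinates:
  fixes d z y :: complex
  assumes "d \<noteq> 0"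
  defines "e \<equiv> - \<i> * d / complex_of_real (norm d)"
  shows "z \<bullet> y = (z \<bullet> d) * (y \<bullet> d) / (norm d)\<^sup>2 + (z \<bullet> e) * (y \<bullet> e)"
proof -
  have nd: "norm d \<noteq> 0" using assms(1) by simp
  have e: "w \<bullet> e = (Re w * Im d - Im w * Re d) / norm d" for w
    by (simp add: e_def inner_complex_def Re_divide_of_real Im_divide_of_real diff_divide_distrib)
  have "(z \<bullet> e) * (y \<bullet> e) = (Re z * Im d - Im z * Re d) * (Re y * Im d - Im y * Re d) / (norm d)\<^sup>2"
    unfolding e by (simp add: power2_eq_square)
  moreover have "(z \<bullet> y) * (norm d)\<^sup>2 = (z \<bullet> d) * (y \<bullet> d) +
      (Re z * Im d - Im z * Re d) * (Re y * Im d - Im y * Re d)"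
    unfolding inner_complex_def cmod_power2 by algebra
  ultimately show ?thesis using nd by (simp add: field_simps)
qed

lemma norm_le_edge_coordinates:
  fixes d z :: complex
  assumes "d \<noteq> 0"
  defines "e \<equiv> - \<i> * d / complex_of_real (norm d)"
  shows "norm z \<le> \<bar>z \<bullet> d\<bar> / norm d + \<bar>z \<bullet> e\<bar>"
proof (rule power2_le_imp_le)
  have "(norm z)\<^sup>2 = (\<bar>z \<bullet> d\<bar> / norm d)\<^sup>2 + \<bar>z \<bullet> e\<bar>\<^sup>2"
    unfolding power2_norm_eq_inner[of z] e_def using inner_edge_coordinates[OF assms(1), of z z]
    by (simp add: power2_eq_square)
  also have "\<dots> \<le> (\<bar>z \<bullet> d\<bar> / norm d + \<bar>z \<bullet> e\<bar>)\<^sup>2"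
    unfolding power2_sum by simp
  finally show "(norm z)\<^sup>2 \<le> (\<bar>z \<bullet> d\<bar> / norm d + \<bar>z \<bullet> e\<bar>)\<^sup>2" .
qed simp

text \<open>The quotient of the exponentials with frequencies \<open>\<gamma> s\<close> and \<open>a\<close> has modulus
  \<open>exp (z \<bullet> (\<gamma> s - a))\<close>.  In the coordinates above, the part of the exponent along \<open>d\<close> is bounded
  and the part along \<open>e\<close> is a negative multiple of \<open>z \<bullet> e\<close>, so the quotient decays exponentially.\<close>

lemma other_terms_negligible:
  fixes d :: complex
  assumes "d \<noteq> 0" "finite I"
  defines "e \<equiv> - \<i> * d / complex_of_real (norm d)"
  assumes below: "\<And>s. s \<in> I \<Longrightarrow> (\<gamma> s - a) \<bullet> e < 0" and "\<eta> > 0"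
  shows "\<exists>T. \<forall>z. \<bar>z \<bullet> d\<bar> \<le> X \<and> T \<le> z \<bullet> e \<longrightarrow>
           norm (\<Sum>s\<in>I. exp_term \<delta> \<gamma> s z) < \<eta> * norm (exp (z * cnj a))"
proof -
  define C where "C = (\<lambda>s. norm (\<delta> s) * exp (X * \<bar>(\<gamma> s - a) \<bullet> d\<bar> / (norm d)\<^sup>2))"
  have "((\<lambda>t. \<Sum>s\<in>I. C s * exp (((\<gamma> s - a) \<bullet> e) * t)) \<longlongrightarrow> 0) at_top"
  proof (rule tendsto_null_sum)
    fix s assume "s \<in> I"
    from below[OF this] have "filterlim (\<lambda>t. ((\<gamma> s - a) \<bullet> e) * t) at_bot at_top"
      by (intro filterlim_tendsto_neg_mult_at_bot[OF tendsto_const]) (auto intro: filterlim_ident)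
    then have "((\<lambda>t. exp (((\<gamma> s - a) \<bullet> e) * t)) \<longlongrightarrow> 0) at_top"
      by (rule filterlim_compose[OF exp_at_bot])
    then show "((\<lambda>t. C s * exp (((\<gamma> s - a) \<bullet> e) * t)) \<longlongrightarrow> 0) at_top"
      by (rule tendsto_mult_right_zero)
  qed
  then have "eventually (\<lambda>t. (\<Sum>s\<in>I. C s * exp (((\<gamma> s - a) \<bullet> e) * t)) < \<eta>) at_top"
    using \<open>\<eta> > 0\<close> by (rule order_tendstoD)
  then obtain T where T: "\<And>t. T \<le> t \<Longrightarrow> (\<Sum>s\<in>I. C s * exp (((\<gamma> s - a) \<bullet> e) * t)) < \<eta>"
    by (auto simp: eventually_at_top_linorder)
  have "norm (\<Sum>s\<in>I. exp_term \<delta> \<gamma> s z) < \<eta> * norm (exp (z * cnj a))"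
    if z: "\<bar>z \<bullet> d\<bar> \<le> X" "T \<le> z \<bullet> e" for z
  proof -
    have "norm (exp_term \<delta> \<gamma> s z)
        \<le> C s * exp (((\<gamma> s - a) \<bullet> e) * (z \<bullet> e)) * norm (exp (z * cnj a))" for s
    proof -
      have "(z \<bullet> d) * ((\<gamma> s - a) \<bullet> d) \<le> \<bar>z \<bullet> d\<bar> * \<bar>(\<gamma> s - a) \<bullet> d\<bar>"
        by (metis abs_ge_self abs_mult)
      also have "\<dots> \<le> X * \<bar>(\<gamma> s - a) \<bullet> d\<bar>" using z by (intro mult_right_mono) auto
      finally have "z \<bullet> (\<gamma> s - a) \<le> X * \<bar>(\<gamma> s - a) \<bullet> d\<bar> / (norm d)\<^sup>2 + ((\<gamma> s - a) \<bullet> e) * (z \<bullet> e)"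
        using inner_edge_coordinates[OF assms(1), of z "\<gamma> s - a"]
        by (simp add: e_def divide_right_mono mult.commute)
      then have "z \<bullet> \<gamma> s \<le>
          X * \<bar>(\<gamma> s - a) \<bullet> d\<bar> / (norm d)\<^sup>2 + ((\<gamma> s - a) \<bullet> e) * (z \<bullet> e) + z \<bullet> a"
        by (simp add: inner_diff_right)
      then have "exp (z \<bullet> \<gamma> s) \<le>
          exp (X * \<bar>(\<gamma> s - a) \<bullet> d\<bar> / (norm d)\<^sup>2) * exp (((\<gamma> s - a) \<bullet> e) * (z \<bullet> e)) * exp (z \<bullet> a)"
        by (simp flip: exp_add)
      then have "norm (\<delta> s) * exp (z \<bullet> \<gamma> s) \<le> norm (\<delta> s) *
          (exp (X * \<bar>(\<gamma> s - a) \<bullet> d\<bar> / (norm d)\<^sup>2) * exp (((\<gamma> s - a) \<bullet> e) * (z \<bullet> e)) * exp (z \<bullet> a))"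
        by (rule mult_left_mono) simp
      then show ?thesis
        by (simp only: exp_term_def norm_mult norm_exp_eq_Re inner_complex_eq_Re C_def mult.assoc)
    qed
    then have "norm (\<Sum>s\<in>I. exp_term \<delta> \<gamma> s z)
        \<le> (\<Sum>s\<in>I. C s * exp (((\<gamma> s - a) \<bullet> e) * (z \<bullet> e)) * norm (exp (z * cnj a)))"
      by (intro sum_norm_le)
    also have "\<dots> = (\<Sum>s\<in>I. C s * exp (((\<gamma> s - a) \<bullet> e) * (z \<bullet> e))) * norm (exp (z * cnj a))"
      by (simp add: sum_distrib_right)
    also have "\<dots> < \<eta> * norm (exp (z * cnj a))"
      using T[OF z(2)] by (intro mult_strict_right_mono) auto
    finally show ?thesis .
  qed
  then show ?thesis by blast
qed

text \<open>This is where the generic case is used: the line through an edge supports \<open>K\<close>, and it contains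
  none of the given points except the two ends of the edge.\<close>

lemma third_point_below_edge_line:
  assumes gen: "generic_case R Q \<delta> \<gamma>" and r: "1 \<le> r" "r \<le> Q"
    and s: "s \<in> {1..R} - {r, prev Q r}"
  shows "(\<gamma> s - \<gamma> (prev Q r)) \<bullet> edge_normal Q \<gamma> r < 0"
proof -
  define K where "K = convex hull (\<gamma> ` {1..R})"
  define a b where "a = \<gamma> (prev Q r)" and "b = \<gamma> r"
  define d where "d = b - a"
  define e where "e = edge_normal Q \<gamma> r"
  have e_def': "e = - \<i> * d / complex_of_real (norm d)"
    by (simp add: e_def edge_normal_def d_def a_def b_def)
  note defs = gen[unfolded generic_case_def anticlockwise_vertices_def, folded K_def]
  have QR: "Q \<le> R" "inj_on \<gamma> {1..R}" using defs by auto
  have p: "prev Q r \<in> {1..Q}" using r by (auto simp: prev_def)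
  have "closed_segment a b edge_of K" using defs r by (auto simp: a_def b_def)
  then have "a \<noteq> b" by (auto simp: edge_of_def)
  then have d: "d \<noteq> 0" by (simp add: d_def)
  have le: "(x - a) \<bullet> e \<le> 0" if "x \<in> K" for x
  proof -
    have "0 \<le> Im ((x - a) * cnj d)" using defs r that by (auto simp: a_def b_def d_def)
    moreover have "(x - a) \<bullet> e = - (Im ((x - a) * cnj d) / norm d)"
      by (simp add: e_def' inner_complex_def Re_divide_of_real Im_divide_of_real
            diff_divide_distrib add_divide_distrib algebra_simps)
    ultimately show ?thesis by simp
  qed
  have inK: "\<gamma> q \<in> K" if "q \<in> {1..R}" for q
    unfolding K_def by (rule hull_inc) (use that in auto)
  have ext: "\<gamma> q extreme_point_of K" if "q \<in> {1..Q}" for q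
    using defs that by (auto simp: bij_betw_def)
  have sK: "\<gamma> s \<in> K" using inK s by auto
  have "(\<gamma> s - a) \<bullet> e \<noteq> 0"
  proof
    assume zero: "(\<gamma> s - a) \<bullet> e = 0"
    show False
    proof (cases "s \<le> Q")
      case False
      \<comment> \<open>An interior point of \<open>K\<close> could still be moved in the direction of the normal.\<close>
      then have "\<gamma> s \<in> interior K" using defs s by auto
      then obtain h where h: "h > 0" "cball (\<gamma> s) h \<subseteq> K" unfolding mem_interior_cball by blast
      have ne: "norm e = 1" using d by (simp add: e_def' norm_divide norm_mult)
      then have "\<gamma> s + of_real h * e \<in> cball (\<gamma> s) h" using h by (simp add: dist_norm norm_mult)
      with h le have "(\<gamma> s + of_real h * e - a) \<bullet> e \<le> 0" by blast
      moreover have "(\<gamma> s + of_real h * e - a) \<bullet> e = (\<gamma> s - a) \<bullet> e + h * (e \<bullet> e)"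
        by (simp add: inner_diff_left inner_add_left flip: scaleR_conv_of_real)
      ultimately show False using zero h ne by (simp flip: power2_norm_eq_inner)
    next
      case True
      \<comment> \<open>Of three distinct collinear points one lies strictly between the other two, so the three
        points are not all extreme.\<close>
      have distinct: "\<gamma> s \<noteq> a" "\<gamma> s \<noteq> b"
        using inj_onD[OF QR(2), of s r] inj_onD[OF QR(2), of s "prev Q r"] s r p QR(1)
        by (auto simp: a_def b_def)
      have "\<gamma> s - a = (((\<gamma> s - a) \<bullet> d) / (norm d)\<^sup>2) *\<^sub>R d"
      proof (subst vector_eq_ldot[symmetric], rule allI)
        show "z \<bullet> (\<gamma> s - a) = z \<bullet> (((\<gamma> s - a) \<bullet> d) / (norm d)\<^sup>2) *\<^sub>R d" for z
          using inner_edge_coordinates[OF d, of z "\<gamma> s - a"] zero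
          by (simp add: e_def' mult.commute)
      qed
      then have "collinear {0, b - a, \<gamma> s - a}"
        unfolding d_def collinear_lemma by blast
      then have "collinear {b, a, \<gamma> s}"
        using collinear_3[of b a "\<gamma> s"] by (simp add: NO_MATCH_def)
      then have "collinear {a, b, \<gamma> s}" by (simp add: insert_commute)
      then have "between (a, b) (\<gamma> s) \<or> between (b, \<gamma> s) a \<or> between (\<gamma> s, a) b"
        unfolding collinear_between_cases by blast
      then have "\<gamma> s \<in> open_segment a b \<or> a \<in> open_segment b (\<gamma> s) \<or> b \<in> open_segment (\<gamma> s) a"
        using distinct \<open>a \<noteq> b\<close> by (auto simp: between_mem_segment open_segment_def)
      moreover have "a extreme_point_of K" "b extreme_point_of K" "\<gamma> s extreme_point_of K"
        using ext r p s True by (auto simp: a_def b_def)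
      ultimately show False unfolding extreme_point_of_def by blast
    qed
  qed
  with le[OF sK] show ?thesis by (simp add: a_def e_def)
qed

section \<open>The edge sum and the theorem\<close>

text \<open>If \<open>exp v\<close> is close to \<open>1\<close>, its principal logarithm is small, and it differs from \<open>v\<close> by a
  multiple of \<open>2 \<pi> \<i>\<close>.  Hence \<open>1 - exp v\<close> is bounded below in terms of the distance of \<open>v\<close> to its
  zeros, uniformly in the whole plane.\<close>

lemma norm_one_minus_exp_ge:
  assumes "\<And>n::int. \<eta> \<le> norm (v - of_int (2 * n) * pi * \<i>)"
  shows "min (1/2) (\<eta>/2) \<le> norm (1 - exp v)"
proof (cases "norm (1 - exp v) < 1/2")
  case True
  have nm: "norm (exp v - 1) < 1/2" using True by (simp add: norm_minus_commute)
  have "exp (Ln (1 + (exp v - 1))) = exp v" by simp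
  then obtain n :: int where n: "Ln (1 + (exp v - 1)) = v + (of_int (2 * n) * pi) * \<i>"
    unfolding exp_eq by blast
  have "\<eta> \<le> norm (v - of_int (2 * (- n)) * pi * \<i>)" by (rule assms)
  also have "\<dots> = norm (Ln (1 + (exp v - 1)))" unfolding n by simp
  also have "\<dots> \<le> 2 * norm (exp v - 1)" by (rule norm_Ln_le[OF nm])
  finally show ?thesis by (simp add: norm_minus_commute)
qed auto

text \<open>This form shows the zeros of the edge sum: for \<open>a \<noteq> b\<close> they are equally spaced points of the
  line on which its two terms have equal modulus.\<close>

lemma edge_sum_factor:
  fixes \<alpha> \<beta> a b z :: complex
  assumes "\<alpha> \<noteq> 0" "\<beta> \<noteq> 0"
  shows "\<beta> * exp (z * cnj b) + \<alpha> * exp (z * cnj a)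
       = \<alpha> * exp (z * cnj a) * (1 - exp (z * cnj (b - a) - Ln (- \<alpha> / \<beta>)))"
proof -
  have "exp (z * cnj (b - a) - Ln (- \<alpha> / \<beta>)) = exp (z * cnj b) / exp (z * cnj a) / (- \<alpha> / \<beta>)"
    using assms by (simp add: exp_diff right_diff_distrib)
  then show ?thesis using assms by (simp add: field_simps)
qed

theorem theorem6:
  fixes R Q r :: nat and \<delta> \<gamma> :: "nat \<Rightarrow> complex" and \<epsilon> :: real
  assumes "generic_case R Q \<delta> \<gamma>"
    and "\<epsilon> > 0"
    and "1 \<le> r" and "r \<le> Q"
  shows "\<exists>A B g. finite A \<and> A \<subseteq> zeros_with_mult (exp_poly R \<delta> \<gamma>) (edge_strip Q \<delta> \<gamma> r \<epsilon>) \<and>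
           finite B \<and> B \<subseteq> zeros_with_mult (edge_sum Q \<delta> \<gamma> r) (edge_strip Q \<delta> \<gamma> r \<epsilon>) \<and>
           bij_betw g (zeros_with_mult (exp_poly R \<delta> \<gamma>) (edge_strip Q \<delta> \<gamma> r \<epsilon>) - A)
                      (zeros_with_mult (edge_sum Q \<delta> \<gamma> r) (edge_strip Q \<delta> \<gamma> r \<epsilon>) - B) \<and>
           (\<forall>\<eta>>0. \<exists>M. \<forall>p \<in> zeros_with_mult (exp_poly R \<delta> \<gamma>) (edge_strip Q \<delta> \<gamma> r \<epsilon>) - A.
              norm (fst p) \<ge> M \<longrightarrow> norm (fst p - fst (g p)) < \<eta>)"
proof -
  define p where "p = prev Q r"
  define a b where "a = \<gamma> p" and "b = \<gamma> r"
  define d where "d = b - a"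
  define e where "e = edge_normal Q \<gamma> r"
  define k where "k = edge_offset Q \<delta> r"
  define t0 where "t0 = b \<bullet> e"
  define S where "S = edge_strip Q \<delta> \<gamma> r \<epsilon>"
  define F where "F = exp_poly R \<delta> \<gamma>"
  define G where "G = edge_sum Q \<delta> \<gamma> r"
  define \<Lambda> where "\<Lambda> = Ln (- \<delta> p / \<delta> r)"
  define v where "v = (\<lambda>z. z * cnj d - \<Lambda>)"
  note gen = assms(1)[unfolded generic_case_def anticlockwise_vertices_def]
  have pr: "p \<in> {1..R}" "r \<in> {1..R}" using assms(3,4) gen by (auto simp: p_def prev_def)
  have "closed_segment a b edge_of convex hull (\<gamma> ` {1..R})"
    using gen assms(3,4) by (auto simp: a_def b_def p_def)
  then have "a \<noteq> b" by (auto simp: edge_of_def)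
  then have d: "d \<noteq> 0" and "p \<noteq> r" by (auto simp: d_def a_def b_def)
  have nd: "norm d > 0" using d by simp
  have \<delta>: "\<delta> p \<noteq> 0" "\<delta> r \<noteq> 0" using gen pr by auto
  have e: "e = - \<i> * d / complex_of_real (norm d)"
    by (simp add: e_def edge_normal_def d_def a_def b_def p_def)
  have norm_e: "norm e = 1" using d by (simp add: e norm_divide norm_mult)
  have S: "z \<in> S \<longleftrightarrow> t0 \<le> z \<bullet> e \<and> \<bar>z \<bullet> d - k\<bar> \<le> \<epsilon>" for z
    by (auto simp: S_def edge_strip_def t0_def e_def k_def d_def a_def b_def p_def)
  have cs_d: "\<bar>z \<bullet> d\<bar> \<le> norm z * norm d" and cs_e: "\<bar>z \<bullet> e\<bar> \<le> norm z" for z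
    using Cauchy_Schwarz_ineq2[of z d] Cauchy_Schwarz_ineq2[of z e] norm_e by auto
  have far: "\<exists>M. \<forall>z\<in>S. M \<le> norm z \<longrightarrow> T \<le> z \<bullet> e" for T
  proof (intro exI ballI impI)
    fix z assume z: "z \<in> S" and big: "(\<bar>k\<bar> + \<epsilon>) / norm d + \<bar>t0\<bar> + \<bar>T\<bar> + 1 \<le> norm z"
    have "norm z \<le> \<bar>z \<bullet> d\<bar> / norm d + \<bar>z \<bullet> e\<bar>"
      using norm_le_edge_coordinates[OF d] by (simp add: e)
    also have "\<bar>z \<bullet> d\<bar> / norm d \<le> (\<bar>k\<bar> + \<epsilon>) / norm d"
      using z by (intro divide_right_mono) (auto simp: S)
    finally show "T \<le> z \<bullet> e" using big z by (auto simp: S)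
  qed
  have G_factor: "G z = \<delta> p * exp (z * cnj a) * (1 - exp (v z))" for z
    unfolding G_def edge_sum_def exp_term_def v_def \<Lambda>_def d_def a_def b_def p_def[symmetric]
    by (rule edge_sum_factor[OF \<delta>])
  have G_zero: "G z = 0 \<longleftrightarrow> (\<exists>n::int. v z = of_int (2 * n) * pi * \<i>)" for z
  proof -
    have "G z = 0 \<longleftrightarrow> exp (v z) = exp 0" using \<delta> by (auto simp: G_factor)
    then show ?thesis unfolding exp_eq by simp
  qed
  have Re_v: "Re (v z) = z \<bullet> d - k" for z
    using \<delta> by (simp add: v_def \<Lambda>_def k_def edge_offset_def inner_complex_eq_Re p_def norm_divide)
  have v_diff: "norm (v z - v w) = dist z w * norm d" for z w
    by (simp add: v_def dist_norm norm_mult flip: left_diff_distrib)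
  have F_split: "F z - G z = (\<Sum>s\<in>{1..R} - {r, p}. exp_term \<delta> \<gamma> s z)" for z
  proof -
    have "(\<Sum>s\<in>{1..R}. exp_term \<delta> \<gamma> s z)
        = (\<Sum>s\<in>{1..R} - {r, p}. exp_term \<delta> \<gamma> s z) + (\<Sum>s\<in>{r, p}. exp_term \<delta> \<gamma> s z)"
      by (rule sum.subset_diff) (use pr in auto)
    then show ?thesis
      using \<open>p \<noteq> r\<close> by (simp add: F_def exp_poly_def G_def edge_sum_def p_def)
  qed
  have dominated: "\<exists>M. \<forall>z\<in>S. M \<le> norm z \<and> (\<forall>w\<in>S. G w = 0 \<longrightarrow> \<rho> \<le> dist w z)
      \<longrightarrow> norm (F z - G z) < norm (G z)" if "\<rho> > 0" for \<rho>
  proof -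
    define m where "m = min (1/2) (\<rho> * norm d / 2)"
    have "m > 0" using \<open>\<rho> > 0\<close> nd by (simp add: m_def)
    have below: "(\<gamma> s - a) \<bullet> e < 0" if "s \<in> {1..R} - {r, p}" for s
      using third_point_below_edge_line[OF assms(1,3,4)] that by (simp add: a_def e_def p_def)
    have "\<exists>T. \<forall>z. \<bar>z \<bullet> d\<bar> \<le> \<bar>k\<bar> + \<epsilon> \<and> T \<le> z \<bullet> e \<longrightarrow>
        norm (F z - G z) < norm (\<delta> p) * m * norm (exp (z * cnj a))"
      unfolding F_split e
      by (rule other_terms_negligible[OF d _ below[unfolded e]]) (use \<open>m > 0\<close> \<delta> in auto)
    then obtain T where T: "\<And>z. \<bar>z \<bullet> d\<bar> \<le> \<bar>k\<bar> + \<epsilon> \<Longrightarrow> T \<le> z \<bullet> e \<Longrightarrow>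
        norm (F z - G z) < norm (\<delta> p) * m * norm (exp (z * cnj a))"
      by blast
    obtain M where M: "\<And>z. z \<in> S \<Longrightarrow> M \<le> norm z \<Longrightarrow> max T (t0 + \<rho>) \<le> z \<bullet> e"
      using far by blast
    have "norm (F z - G z) < norm (G z)"
      if z: "z \<in> S" "M \<le> norm z" and away: "\<forall>w\<in>S. G w = 0 \<longrightarrow> \<rho> \<le> dist w z" for z
    proof -
      have "\<rho> * norm d \<le> norm (v z - of_int (2 * n) * pi * \<i>)" for n :: int
      proof -
        define w where "w = (\<Lambda> + of_int (2 * n) * pi * \<i>) / cnj d"
        have vw: "v w = of_int (2 * n) * pi * \<i>" using d by (simp add: v_def w_def)
        then have Gw: "G w = 0" using G_zero by blast
        have "\<rho> \<le> dist z w"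
        proof (cases "w \<in> S")
          case True
          with away Gw show ?thesis by (simp add: dist_commute)
        next
          \<comment> \<open>A zero of \<open>G\<close> lies on the centre line of the strip, so it can only fail to be in \<open>S\<close>
            by lying beyond the end of the strip, far away from \<open>z\<close>.\<close>
          case False
          have "w \<bullet> d - k = 0" using Re_v[of w] vw by simp
          with False have "w \<bullet> e < t0" using assms(2) by (auto simp: S)
          with M[OF z] have "\<rho> \<le> (z - w) \<bullet> e" by (simp add: inner_diff_left)
          also have "\<dots> \<le> dist z w" using cs_e[of "z - w"] by (simp add: dist_norm)
          finally show ?thesis .
        qed
        then show ?thesis using v_diff[of z w] nd by (simp add: vw)
      qed
      then have "m \<le> norm (1 - exp (v z))"
        unfolding m_def by (rule norm_one_minus_exp_ge)
      then have "norm (\<delta> p) * norm (exp (z * cnj a)) * m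
          \<le> norm (\<delta> p) * norm (exp (z * cnj a)) * norm (1 - exp (v z))"
        by (intro mult_left_mono) auto
      then have "norm (\<delta> p) * m * norm (exp (z * cnj a)) \<le> norm (G z)"
        by (simp only: G_factor norm_mult mult_ac)
      moreover have "norm (F z - G z) < norm (\<delta> p) * m * norm (exp (z * cnj a))"
        using M[OF z] z(1) by (intro T) (auto simp: S)
      ultimately show ?thesis by linarith
    qed
    then show ?thesis by blast
  qed
  have F_deriv: "(exp_term \<delta> \<gamma> s has_field_derivative cnj (\<gamma> s) * exp_term \<delta> \<gamma> s z) (at z)" for s z
    unfolding exp_term_def [abs_def] by (auto intro!: derivative_eq_intros)
  have holF: "F holomorphic_on UNIV"
    unfolding F_def exp_poly_def[abs_def] exp_term_def by (intro holomorphic_intros)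
  have holG: "G holomorphic_on UNIV"
    unfolding G_def edge_sum_def[abs_def] exp_term_def by (intro holomorphic_intros)
  have simple: "zorder G w = 1" if "G w = 0" for w
  proof (rule zorder_simple_zero_DERIV[OF holG _ _ that])
    show "(G has_field_derivative cnj b * exp_term \<delta> \<gamma> r w + cnj a * exp_term \<delta> \<gamma> p w) (at w)"
      unfolding G_def edge_sum_def[abs_def] p_def[symmetric] a_def b_def
      by (intro derivative_intros F_deriv)
    have "exp_term \<delta> \<gamma> r w = - exp_term \<delta> \<gamma> p w"
      using that by (simp add: G_def edge_sum_def p_def eq_neg_iff_add_eq_0)
    then have "cnj b * exp_term \<delta> \<gamma> r w + cnj a * exp_term \<delta> \<gamma> p w = - cnj d * exp_term \<delta> \<gamma> p w"
      by (simp add: d_def algebra_simps)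
    then show "cnj b * exp_term \<delta> \<gamma> r w + cnj a * exp_term \<delta> \<gamma> p w \<noteq> 0"
      using d \<delta> by (simp add: exp_term_def)
  qed auto
  define \<rho> where "\<rho> = min (pi / norm d) (\<epsilon> / norm d)"
  have \<rho>: "\<rho> > 0" "\<rho> * norm d \<le> pi" "\<rho> * norm d \<le> \<epsilon>"
    using nd assms(2) by (auto simp: \<rho>_def min_def field_simps)
  have sep: "2 * \<rho> \<le> dist w w'" if zeros: "G w = 0" "G w' = 0" and "w \<noteq> w'" for w w'
  proof -
    obtain n n' :: int where n: "v w = of_int (2 * n) * pi * \<i>" "v w' = of_int (2 * n') * pi * \<i>"
      using zeros G_zero by blast
    have "n \<noteq> n'" using v_diff[of w w'] n nd \<open>w \<noteq> w'\<close> by auto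
    then have "1 \<le> \<bar>n - n'\<bar>" by simp
    then have "1 \<le> \<bar>real_of_int (n - n')\<bar>" by linarith
    then have "2 * pi * 1 \<le> 2 * pi * \<bar>real_of_int (n - n')\<bar>" by (intro mult_left_mono) auto
    also have "\<dots> = norm (v w - v w')"
    proof -
      have "v w - v w' = of_real (2 * pi * real_of_int (n - n')) * \<i>"
        unfolding n by (simp add: algebra_simps)
      then show ?thesis by (simp only: norm_mult norm_of_real) (simp add: abs_mult)
    qed
    finally have "2 * (\<rho> * norm d) \<le> dist w w' * norm d" using \<rho> by (simp add: v_diff)
    then show ?thesis using nd by simp
  qed
  obtain M0 where M0: "\<And>z. z \<in> S \<Longrightarrow> M0 \<le> norm z \<Longrightarrow> t0 + \<rho> \<le> z \<bullet> e" using far by blast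
  have inside: "cball w \<rho> \<subseteq> S" if w: "w \<in> S" "G w = 0" "M0 \<le> norm w" for w
  proof
    fix z assume z: "z \<in> cball w \<rho>"
    have "Re (v w) = 0" using w(2) G_zero[of w] by auto
    then have "\<bar>z \<bullet> d - k\<bar> = \<bar>(z - w) \<bullet> d\<bar>" using Re_v[of w] by (simp add: inner_diff_left)
    also have "\<dots> \<le> norm (z - w) * norm d" by (rule cs_d)
    also have "\<dots> \<le> \<rho> * norm d"
      using z by (intro mult_right_mono) (auto simp: dist_norm norm_minus_commute)
    finally have "\<bar>z \<bullet> d - k\<bar> \<le> \<epsilon>" using \<rho> by linarith
    moreover have "t0 \<le> z \<bullet> e"
      using M0[OF w(1,3)] cs_e[of "z - w"] z by (simp add: inner_diff_left dist_norm norm_minus_commute)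
    ultimately show "z \<in> S" by (simp add: S)
  qed
  \<comment> \<open>Neither function vanishes identically: the side \<open>z \<bullet> d = k + \<epsilon>\<close> of the strip stays away
    from the zeros of \<open>G\<close>, so far out on it \<open>G\<close> dominates \<open>F - G\<close>.\<close>
  obtain z0 where z0: "norm (F z0 - G z0) < norm (G z0)"
  proof -
    obtain M where M: "\<And>z. z \<in> S \<Longrightarrow> M \<le> norm z \<Longrightarrow> (\<forall>w\<in>S. G w = 0 \<longrightarrow> \<rho> \<le> dist w z)
      \<Longrightarrow> norm (F z - G z) < norm (G z)" using dominated[OF \<rho>(1)] by blast
    define z where "z = ((k + \<epsilon>) / (norm d)\<^sup>2) *\<^sub>R d + (\<bar>M\<bar> + \<bar>t0\<bar>) *\<^sub>R e"
    have "e \<bullet> d = 0" using nd by (simp add: e inner_complex_def Re_divide_of_real Im_divide_of_real)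
    then have zd: "z \<bullet> d = k + \<epsilon>" and ze: "z \<bullet> e = \<bar>M\<bar> + \<bar>t0\<bar>"
      using d norm_e by (simp_all add: z_def inner_add_left inner_commute[of d e] flip: power2_norm_eq_inner)
    show ?thesis
    proof (rule that, rule M)
      show "z \<in> S" using zd ze assms(2) by (simp add: S)
      show "M \<le> norm z" using cs_e[of z] ze by linarith
      show "\<forall>w\<in>S. G w = 0 \<longrightarrow> \<rho> \<le> dist w z"
      proof (intro ballI impI)
        fix w assume "G w = 0"
        then have "Re (v w) = 0" using G_zero[of w] by auto
        then have "w \<bullet> d = k" using Re_v[of w] by simp
        with zd have "\<epsilon> \<le> (z - w) \<bullet> d" by (simp add: inner_diff_left)
        also have "\<dots> \<le> norm (z - w) * norm d" using cs_d[of "z - w"] by simp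
        finally have "\<rho> * norm d \<le> dist w z * norm d"
          using \<rho> by (simp add: dist_norm norm_minus_commute)
        then show "\<rho> \<le> dist w z" using nd by simp
      qed
    qed
  qed
  have "F z0 \<noteq> 0" "G z0 \<noteq> 0" using z0 by (auto simp: norm_minus_commute)
  then show ?thesis
    unfolding F_def[symmetric] G_def[symmetric] S_def[symmetric]
    by (rule matching_zeros_at_infinity[where L = M0, OF holF holG _ _ \<rho>(1)])
       (rule simple sep inside dominated; assumption)+
qed

end
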